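(* Let $(X_i)_{i\ge 1}$ be a sequence of i.i.d. real-valued random variables with $\mathbb{E}[|X_1|^2]<\infty$, $\mu=\mathbb{E}[X_1]<0$, and $\mathbb{E}[e^{sX_1}]=\infty$ for every $s>0$. For $y>0$ let $M(y)=\sup_{n\ge 0}S_n(y)$, where $S_0(y)=0$ and $S_n(y)=\sum_{i=1}^n\min\{X_i,y\}$ for $n\ge 1$. Let $q(x)=-\log\mathbb{P}(X_1>x)$. Suppose that there exist $\kappa\in(0,1)$ and $y_\kappa>0$ such that $$(\log y)^{1+\kappa}\le q(y)\le y^{1-\kappa}\qquad\text{for all } y\ge y_\kappa,$$ and that $q$ is concave on $(0,\infty)$. Then, for every $\eta\in(0,1)$, there exists $y_\eta^*<\infty$ such that $$\mathbb{P}(M(y)>x)\le\left(\frac{y\,\mathbb{P}(X_1>y)}{\eta|\mu|}\right)^{x/y}\qquad\text{for all } x>0 \text{ and all } y>0 \text{ with } y>y_\eta^* .$$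
   Context: The threshold $y_\eta^*$ is a constant that may depend on $\eta$, $\kappa$, $y_\kappa$ and the distribution of $X_1$, but not on $x$ or $y$. Here $\log$ is the natural logarithm. *)

theory Defs
  imports "HOL-Probability.Probability"
begin

definition iid :: "'a measure \<Rightarrow> (nat \<Rightarrow> 'a \<Rightarrow> real) \<Rightarrow> bool" where
  "iid M X \<longleftrightarrow>
     prob_space.indep_vars M (\<lambda>_. borel) X {1..} \<and>
     (\<forall>i\<ge>1. distr M borel (X i) = distr M borel (X 1))"

definition truncated_walk :: "(nat \<Rightarrow> 'a \<Rightarrow> real) \<Rightarrow> real \<Rightarrow> nat \<Rightarrow> 'a \<Rightarrow> real" where
  "truncated_walk X y n \<omega> = (\<Sum>i=1..n. min (X i \<omega>) y)"

(* The supremum is taken in the extended reals: on the null set where the walk is unbounded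
   above it equals infinity, whereas a supremum in the reals would be unspecified there. *)
definition walk_sup :: "(nat \<Rightarrow> 'a \<Rightarrow> real) \<Rightarrow> real \<Rightarrow> 'a \<Rightarrow> ereal" where
  "walk_sup X y \<omega> = (SUP n. ereal (truncated_walk X y n \<omega>))"

(* Real-valued; meaningful where the tail is positive, which holds for every x as soon as
   all positive exponential moments of Y are infinite. *)
definition neg_log_tail :: "'a measure \<Rightarrow> ('a \<Rightarrow> real) \<Rightarrow> real \<Rightarrow> real" where
  "neg_log_tail M Y x = - ln \<P>(\<omega> in M. Y \<omega> > x)"

end

theory Submission
  imports Defs "HOL-Real_Asymp.Real_Asymp"
begin

text \<open>
  Put \<open>a = \<eta> \<bar>\<mu>\<bar>\<close>, \<open>p z = \<P>(X\<^sub>1 > z) = exp (- q z)\<close> and \<open>s = ln (a / (y p y)) / y\<close>, so that the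
  right-hand side is \<open>exp (- s x)\<close>. By Lundberg's inequality it suffices that
  \<open>E (exp (s min(X\<^sub>1, y))) \<le> 1\<close>. The quadratic Taylor bound where \<open>s X\<^sub>1 \<le> 1\<close>, and integration by
  parts elsewhere, bound this expectation by \<open>1 + s \<mu> + s\<^sup>2 E (X\<^sub>1\<^sup>2) + s y C\<close>, where \<open>C\<close> bounds
  \<open>exp (s z - q z)\<close> on \<open>[1/s, y]\<close>. As \<open>q\<close> is concave, this function attains its maximum at an
  endpoint. At \<open>y\<close> its value is \<open>a / y\<close>; at \<open>1/s\<close> it is \<open>o(1/y)\<close>, because \<open>s \<le> q y / y \<le> y powr - \<kappa>\<close>
  and \<open>p (y powr \<kappa>)\<close> decays faster than every power of \<open>y\<close>. So for large \<open>y\<close> one may take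
  \<open>C = a / y\<close>, and the bound becomes \<open>1 + s (\<mu> + \<eta> \<bar>\<mu>\<bar> + o(1)) \<le> 1\<close>.
\<close>

section \<open>Exponential moments and Lundberg's inequality\<close>

text \<open>For negative \<open>u\<close>, multiply both sides by \<open>1 - u > 0\<close>: the left
  becomes at most \<open>exp u * exp (- u) = 1\<close>, the right becomes \<open>1 - u ^ 3\<close>,
  which exceeds 1. All negative \<open>u\<close> are covered because the steps of the walk are not
  assumed bounded below.\<close>

lemma exp_le_quadratic:
  fixes u :: real
  assumes "u \<le> 1"
  shows "exp u \<le> 1 + u + u\<^sup>2"
proof (cases "0 \<le> u")
  case True
  then show ?thesis using assms exp_bound by blast
next
  case False
  have "exp u * (1 - u) \<le> exp u * exp (- u)"
    using exp_ge_add_one_self[of "-u"] by (intro mult_left_mono) auto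
  also have "\<dots> = 1" by (simp flip: exp_add)
  also have "1 \<le> 1 - u ^ 3"
    using False by (simp add: power_less_zero_eq less_imp_le)
  also have "\<dots> = (1 + u + u\<^sup>2) * (1 - u)"
    by (simp add: algebra_simps power2_eq_square power3_eq_cube)
  finally show ?thesis
    using False by (auto dest: mult_right_le_imp_le)
qed

text \<open>The product rule in \<open>ennreal\<close> carries no integrability conditions.
  \<open>indep_var\<close> is independence of a family over the booleans; as both target spaces are
  \<open>borel\<close>, that family of spaces is constant, and the rule for indexed families
  applies.\<close>

lemma (in prob_space) indep_var_nn_integral_mult:
  fixes f g :: "'a \<Rightarrow> ennreal"
  assumes "indep_var borel f borel g"
  shows "(\<integral>\<^sup>+\<omega>. f \<omega> * g \<omega> \<partial>M) = (\<integral>\<^sup>+\<omega>. f \<omega> \<partial>M) * (\<integral>\<^sup>+\<omega>. g \<omega> \<partial>M)"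
proof -
  have *: "case_bool borel borel = (\<lambda>_::bool. borel :: ennreal measure)"
    by (auto simp: fun_eq_iff split: bool.split)
  have "indep_vars (\<lambda>_. borel) (case_bool f g) UNIV"
    using assms unfolding indep_var_def * .
  from indep_vars_nn_integral[OF _ this] show ?thesis
    by (simp add: UNIV_bool mult.commute)
qed

text \<open>
  The process \<open>exp (s * S n)\<close>, frozen at \<open>exp (s * x)\<close> once the walk has exceeded \<open>x\<close>, has
  nonincreasing expectation.
\<close>
lemma (in prob_space) Lundberg_inequality:
  fixes Y :: "nat \<Rightarrow> 'a \<Rightarrow> real"
  assumes indep: "indep_vars (\<lambda>_. borel) Y {1..}"
    and s: "0 \<le> s"
    and mgf: "\<And>i. 1 \<le> i \<Longrightarrow> (\<integral>\<^sup>+\<omega>. ennreal (exp (s * Y i \<omega>)) \<partial>M) \<le> 1"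
  shows "prob {\<omega> \<in> space M. \<exists>n. x < (\<Sum>i=1..n. Y i \<omega>)} \<le> exp (- (s * x))"
proof -
  define S where "S n \<omega> = (\<Sum>i=1..n. Y i \<omega>)" for n \<omega>
  define B where "B n = {\<omega> \<in> space M. \<exists>k\<le>n. x < S k \<omega>}" for n
  \<comment> \<open>Freezing at the level \<open>exp (s * x)\<close> discards the overshoot. As
    \<open>s \<ge> 0\<close>, this is no more than the value of
    \<open>exp (s * S k \<omega>)\<close> at the crossing.\<close>
  define G where "G n \<omega> = (if \<exists>k\<le>n. x < S k \<omega> then exp (s * x) else exp (s * S n \<omega>))" for n \<omega>
  have rv: "Y i \<in> borel_measurable M" if "i \<ge> 1" for i
    using indep that by (auto simp: indep_vars_def)
  have S_meas [measurable]: "S n \<in> borel_measurable M" for n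
    unfolding S_def using rv by (intro borel_measurable_sum) auto
  have B_meas [measurable]: "B n \<in> sets M" for n
    unfolding B_def by measurable
  have G_meas [measurable]: "G n \<in> borel_measurable M" for n
    unfolding G_def by measurable
  have EG: "(\<integral>\<^sup>+\<omega>. ennreal (G n \<omega>) \<partial>M) \<le> 1" for n
  proof (induction n)
    case 0
    have "G 0 \<omega> \<le> 1" for \<omega>
      using s by (auto simp: G_def S_def mult_nonneg_nonpos)
    then have "(\<integral>\<^sup>+\<omega>. ennreal (G 0 \<omega>) \<partial>M) \<le> (\<integral>\<^sup>+\<omega>. 1 \<partial>M)"
      by (intro nn_integral_mono) (simp add: ennreal_le_1)
    then show ?case by (simp add: emeasure_space_1)
  next
    case (Suc n)
    \<comment> \<open>The part of \<open>G n\<close> on paths that have not crossed, as a function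
      of the coordinates 1 to \<open>n\<close> alone, so that independence of disjoint blocks of
      indices separates it from step \<open>Suc n\<close>.\<close>
    define \<phi> :: "(nat \<Rightarrow> real) \<Rightarrow> ennreal" where
      "\<phi> v = (if \<exists>k\<le>n. x < (\<Sum>i=1..k. v i) then 0 else ennreal (exp (s * (\<Sum>i=1..n. v i))))" for v
    define f where "f \<omega> = \<phi> (\<lambda>i\<in>{1..n}. Y i \<omega>)" for \<omega>
    have f_eq: "f \<omega> = (if \<exists>k\<le>n. x < S k \<omega> then 0 else ennreal (exp (s * S n \<omega>)))" for \<omega>
    proof -
      have "(\<Sum>i=1..k. (\<lambda>i\<in>{1..n}. Y i \<omega>) i) = S k \<omega>" if "k \<le> n" for k
        unfolding S_def using that by (intro sum.cong) auto
      then show ?thesis by (auto simp: f_def \<phi>_def)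
    qed
    have f_meas [measurable]: "f \<in> borel_measurable M"
      unfolding f_eq by measurable
    have Y_meas [measurable]: "Y (Suc n) \<in> borel_measurable M"
      using rv by simp
    have coord: "(\<lambda>v. \<Sum>i=1..k. v i) \<in> borel_measurable (PiM {1..n} (\<lambda>_. borel :: real measure))"
      if "k \<le> n" for k
      using that by (intro borel_measurable_sum measurable_component_singleton) auto
    have "\<phi> \<in> borel_measurable (PiM {1..n} (\<lambda>_. borel))"
    proof -
      have "{v \<in> space (PiM {1..n} (\<lambda>_. borel)). \<exists>k\<in>{..n}. x < (\<Sum>i=1..k. v i)}
              \<in> sets (PiM {1..n} (\<lambda>_. borel :: real measure))"
        using coord by (intro sets.sets_Collect_finite_Ex borel_measurable_less) auto
      then have "Measurable.pred (PiM {1..n} (\<lambda>_. borel)) (\<lambda>v::nat \<Rightarrow> real. \<exists>k\<le>n. x < (\<Sum>i=1..k. v i))"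
        by (simp add: pred_def Bex_def)
      note [measurable] = this coord[OF order_refl]
      show ?thesis unfolding \<phi>_def by measurable
    qed
    moreover have "(\<lambda>v. ennreal (exp (s * v (Suc n)))) \<in> borel_measurable (PiM {Suc n} (\<lambda>_. borel))"
      by measurable
    ultimately have "indep_var borel (\<phi> \<circ> (\<lambda>\<omega>. \<lambda>i\<in>{1..n}. Y i \<omega>))
        borel ((\<lambda>v. ennreal (exp (s * v (Suc n)))) \<circ> (\<lambda>\<omega>. \<lambda>i\<in>{Suc n}. Y i \<omega>))"
      by (intro indep_var_compose[OF indep_var_restrict[OF indep]]) auto
    then have "indep_var borel f borel (\<lambda>\<omega>. ennreal (exp (s * Y (Suc n) \<omega>)))"
      by (simp add: comp_def f_def[abs_def])
    then have "(\<integral>\<^sup>+\<omega>. f \<omega> * ennreal (exp (s * Y (Suc n) \<omega>)) \<partial>M)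
        = (\<integral>\<^sup>+\<omega>. f \<omega> \<partial>M) * (\<integral>\<^sup>+\<omega>. ennreal (exp (s * Y (Suc n) \<omega>)) \<partial>M)"
      by (rule indep_var_nn_integral_mult)
    also have "\<dots> \<le> (\<integral>\<^sup>+\<omega>. f \<omega> \<partial>M) * 1"
      by (intro mult_left_mono mgf) auto
    finally have step: "(\<integral>\<^sup>+\<omega>. f \<omega> * ennreal (exp (s * Y (Suc n) \<omega>)) \<partial>M) \<le> (\<integral>\<^sup>+\<omega>. f \<omega> \<partial>M)"
      by simp
    have "(\<integral>\<^sup>+\<omega>. ennreal (G (Suc n) \<omega>) \<partial>M)
        \<le> (\<integral>\<^sup>+\<omega>. ennreal (exp (s * x)) * indicator (B n) \<omega> + f \<omega> * ennreal (exp (s * Y (Suc n) \<omega>)) \<partial>M)"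
    proof (rule nn_integral_mono)
      fix \<omega> assume \<omega>: "\<omega> \<in> space M"
      have S_Suc: "S (Suc n) \<omega> = S n \<omega> + Y (Suc n) \<omega>" by (simp add: S_def)
      show "ennreal (G (Suc n) \<omega>)
        \<le> ennreal (exp (s * x)) * indicator (B n) \<omega> + f \<omega> * ennreal (exp (s * Y (Suc n) \<omega>))"
      proof (cases "\<exists>k\<le>n. x < S k \<omega>")
        case True
        then have "\<exists>k\<le>Suc n. x < S k \<omega>" using le_SucI by blast
        then show ?thesis using True \<omega> by (simp add: G_def B_def f_eq)
      next
        case False
        \<comment> \<open>A path that crosses exactly at \<open>Suc n\<close> has
          \<open>x < S (Suc n) \<omega>\<close>, so its frozen value is below the exponential of the
          walk; otherwise equality holds.\<close>
        have "G (Suc n) \<omega> \<le> exp (s * S (Suc n) \<omega>)"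
          using False s by (auto simp: G_def le_Suc_eq intro!: mult_left_mono)
        then have "ennreal (G (Suc n) \<omega>) \<le> ennreal (exp (s * S n \<omega>)) * ennreal (exp (s * Y (Suc n) \<omega>))"
          by (simp add: S_Suc distrib_left exp_add ennreal_leI flip: ennreal_mult)
        moreover have "f \<omega> = ennreal (exp (s * S n \<omega>))"
          using False by (auto simp: f_eq)
        ultimately show ?thesis by (simp add: add_increasing)
      qed
    qed
    also have "\<dots> = (\<integral>\<^sup>+\<omega>. ennreal (exp (s * x)) * indicator (B n) \<omega> \<partial>M)
        + (\<integral>\<^sup>+\<omega>. f \<omega> * ennreal (exp (s * Y (Suc n) \<omega>)) \<partial>M)"
      by (rule nn_integral_add) measurable
    also have "\<dots> \<le> (\<integral>\<^sup>+\<omega>. ennreal (exp (s * x)) * indicator (B n) \<omega> \<partial>M) + (\<integral>\<^sup>+\<omega>. f \<omega> \<partial>M)"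
      by (intro add_left_mono step)
    also have "\<dots> = (\<integral>\<^sup>+\<omega>. ennreal (exp (s * x)) * indicator (B n) \<omega> + f \<omega> \<partial>M)"
      by (rule nn_integral_add[symmetric]) measurable
    \<comment> \<open>The crossed and uncrossed parts together are \<open>G n\<close> again, which
      closes the induction.\<close>
    also have "\<dots> = (\<integral>\<^sup>+\<omega>. ennreal (G n \<omega>) \<partial>M)"
      by (intro nn_integral_cong) (auto simp: G_def B_def f_eq)
    also have "\<dots> \<le> 1" by (fact Suc)
    finally show ?case .
  qed
  have PB: "prob (B n) \<le> exp (- (s * x))" for n
  proof -
    have "ennreal (exp (s * x) * prob (B n)) = (\<integral>\<^sup>+\<omega>. ennreal (exp (s * x)) * indicator (B n) \<omega> \<partial>M)"
      by (simp add: nn_integral_cmult_indicator emeasure_eq_measure ennreal_mult)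
    also have "\<dots> \<le> (\<integral>\<^sup>+\<omega>. ennreal (G n \<omega>) \<partial>M)"
      by (intro nn_integral_mono) (auto simp: G_def B_def split: split_indicator)
    also have "\<dots> \<le> ennreal 1" using EG by simp
    finally have "exp (s * x) * prob (B n) \<le> 1" by (subst (asm) ennreal_le_iff) auto
    then show ?thesis by (simp add: exp_minus field_simps)
  qed
  \<comment> \<open>Continuity from below passes from finite horizons to the event that the walk
    ever crosses.\<close>
  have "(\<lambda>n. prob (B n)) \<longlonglongrightarrow> prob (\<Union>n. B n)"
    by (intro finite_Lim_measure_incseq) (auto simp: incseq_def B_def intro: le_trans)
  then have "prob (\<Union>n. B n) \<le> exp (- (s * x))"
    using PB by (intro LIMSEQ_le_const2) auto
  also have "(\<Union>n. B n) = {\<omega> \<in> space M. \<exists>n. x < (\<Sum>i=1..n. Y i \<omega>)}"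
    by (auto simp: B_def S_def)
  finally show ?thesis .
qed

section \<open>The moment generating function of a truncated variable\<close>

text \<open>
  Up to \<open>1 / s\<close> the exponential is bounded by its quadratic Taylor polynomial; above \<open>1 / s\<close>
  its expectation is an integral of \<open>s * exp (s * z) * \<P>(Z > z)\<close> over \<open>z\<close> between \<open>1 / s\<close> and \<open>y\<close>.
\<close>
lemma (in prob_space) truncated_mgf_le:
  fixes Z :: "'a \<Rightarrow> real"
  assumes Z [measurable]: "random_variable borel Z"
    and int2: "integrable M (\<lambda>\<omega>. (Z \<omega>)\<^sup>2)"
    and s: "0 < s" and sy: "1 \<le> s * y"
    and tail: "\<And>z. 1 / s \<le> z \<Longrightarrow> z \<le> y \<Longrightarrow> exp (s * z) * \<P>(\<omega> in M. z < Z \<omega>) \<le> C"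
  shows "(\<integral>\<^sup>+\<omega>. ennreal (exp (s * min (Z \<omega>) y)) \<partial>M)
    \<le> ennreal (1 + s * expectation Z + s\<^sup>2 * expectation (\<lambda>\<omega>. (Z \<omega>)\<^sup>2) + s * y * C)"
proof -
  define r where "r = 1 / s"
  have r: "0 < r" "s * r = 1" "r \<le> y" using s sy by (auto simp: r_def field_simps)
  have y: "0 < y" using r by linarith
  have C0: "0 \<le> C" using tail[of r] r by (force simp: r_def intro: order_trans[rotated])
  have int1: "integrable M Z" using square_integrable_imp_integrable[OF Z int2] .
  have pt: "ennreal (exp (s * min (Z \<omega>) y))
      \<le> (ennreal (1 + s * Z \<omega> + s\<^sup>2 * (Z \<omega>)\<^sup>2) + ennreal (exp 1) * indicator {\<omega> \<in> space M. r < Z \<omega>} \<omega>)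
        + (\<integral>\<^sup>+z. ennreal (s * exp (s * z)) * indicator {r..y} z * (if z < Z \<omega> then 1 else 0) \<partial>lborel)"
    (is "_ \<le> ?Q \<omega> + ?I \<omega>")
    if \<omega>: "\<omega> \<in> space M" for \<omega>
  proof (cases "s * min (Z \<omega>) y \<le> 1")
    case True
    have "exp (s * min (Z \<omega>) y) \<le> 1 + s * min (Z \<omega>) y + s\<^sup>2 * (min (Z \<omega>) y)\<^sup>2"
      using exp_le_quadratic[OF True] by (simp add: power_mult_distrib)
    \<comment> \<open>Truncation at \<open>y > 0\<close> increases neither the linear nor the
      quadratic term: where it acts, \<open>0 < y \<le> Z \<omega>\<close>.\<close>
    also have "\<dots> \<le> 1 + s * Z \<omega> + s\<^sup>2 * (Z \<omega>)\<^sup>2"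
      using s y by (intro add_mono mult_left_mono)
        (auto simp: min_def intro!: power_mono)
    finally have "ennreal (exp (s * min (Z \<omega>) y)) \<le> ennreal (1 + s * Z \<omega> + s\<^sup>2 * (Z \<omega>)\<^sup>2)"
      by (rule ennreal_leI)
    then show ?thesis by (simp add: add_increasing2 add.assoc)
  next
    case False
    define u where "u = min (Z \<omega>) y"
    have "s * r < s * u" using False r by (simp add: u_def)
    then have u: "r < u" "u \<le> y" "u \<le> Z \<omega>" using s by (auto simp: u_def)
    have "ennreal (exp (s * u)) = ennreal (exp 1) + ennreal (exp (s * u) - exp (s * r))"
      using r \<open>s * r < s * u\<close> by (subst ennreal_plus[symmetric]) auto
    also have "ennreal (exp (s * u) - exp (s * r))
        = (\<integral>\<^sup>+z. ennreal (s * exp (s * z)) * indicator {r..u} z \<partial>lborel)"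
      using s u by (intro nn_integral_FTC_Icc[symmetric]) (auto intro!: derivative_eq_intros)
    also have "\<dots> \<le> ?I \<omega>"
    proof (rule nn_integral_mono_AE)
      \<comment> \<open>At \<open>z = u\<close> the strict indicator \<open>z < Z \<omega>\<close>
        can fail, namely when \<open>u = Z \<omega>\<close>; a single point is a null set.\<close>
      have "AE z in lborel. z \<noteq> u" by (rule AE_lborel_singleton)
      then show "AE z in lborel. ennreal (s * exp (s * z)) * indicator {r..u} z
          \<le> ennreal (s * exp (s * z)) * indicator {r..y} z * (if z < Z \<omega> then 1 else 0)"
        by (rule eventually_mono) (use u in \<open>auto split: split_indicator\<close>)
    qed
    finally have "ennreal (exp (s * u)) \<le> ennreal (exp 1) + ?I \<omega>" by (simp add: add_left_mono)
    also have "\<dots> \<le> ?Q \<omega> + ?I \<omega>"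
      using u \<omega> by (intro add_right_mono) (simp add: add_increasing)
    finally show ?thesis by (simp add: u_def)
  qed
  have I_meas [measurable]: "?I \<in> borel_measurable M"
    by measurable
  have pos: "0 \<le> 1 + s * Z \<omega> + s\<^sup>2 * (Z \<omega>)\<^sup>2" for \<omega>
  proof -
    \<comment> \<open>Completing the square shows that the quadratic polynomial is nonnegative, so
      its \<open>ennreal\<close> integral is its expectation.\<close>
    have "0 \<le> (1 + s * Z \<omega> / 2)\<^sup>2 + 3 / 4 * (s * Z \<omega>)\<^sup>2" by simp
    then show ?thesis by (simp add: power2_eq_square algebra_simps)
  qed
  have "0 \<le> expectation (\<lambda>\<omega>. 1 + s * Z \<omega> + s\<^sup>2 * (Z \<omega>)\<^sup>2)"
    using pos by (intro integral_nonneg_AE) auto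
  then have nn: "0 \<le> 1 + s * expectation Z + s\<^sup>2 * expectation (\<lambda>\<omega>. (Z \<omega>)\<^sup>2)"
    using int1 int2 by (simp add: prob_space)
  have Q: "(\<integral>\<^sup>+\<omega>. ?Q \<omega> \<partial>M)
    \<le> ennreal (1 + s * expectation Z + s\<^sup>2 * expectation (\<lambda>\<omega>. (Z \<omega>)\<^sup>2) + C)"
  proof -
    have "(\<integral>\<^sup>+\<omega>. ennreal (1 + s * Z \<omega> + s\<^sup>2 * (Z \<omega>)\<^sup>2) \<partial>M)
        = ennreal (expectation (\<lambda>\<omega>. 1 + s * Z \<omega> + s\<^sup>2 * (Z \<omega>)\<^sup>2))"
      using pos int1 int2 by (intro nn_integral_eq_integral) auto
    also have "expectation (\<lambda>\<omega>. 1 + s * Z \<omega> + s\<^sup>2 * (Z \<omega>)\<^sup>2)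
        = 1 + s * expectation Z + s\<^sup>2 * expectation (\<lambda>\<omega>. (Z \<omega>)\<^sup>2)"
      using int1 int2 by (simp add: prob_space)
    finally have E: "(\<integral>\<^sup>+\<omega>. ennreal (1 + s * Z \<omega> + s\<^sup>2 * (Z \<omega>)\<^sup>2) \<partial>M) = \<dots>"
      by simp
    have "(\<integral>\<^sup>+\<omega>. ennreal (exp 1) * indicator {\<omega> \<in> space M. r < Z \<omega>} \<omega> \<partial>M)
        = ennreal (exp (s * r) * \<P>(\<omega> in M. r < Z \<omega>))"
      using r by (simp add: nn_integral_cmult_indicator emeasure_eq_measure ennreal_mult)
    \<comment> \<open>The boundary term at \<open>r = 1 / s\<close> is the case \<open>z = r\<close>
      of the tail hypothesis, because \<open>exp (s * r) = exp 1\<close>.\<close>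
    also have "\<dots> \<le> ennreal C"
      using tail[of r] r by (intro ennreal_leI) (simp add: r_def)
    finally show ?thesis
      using nn C0 by (simp add: nn_integral_add E ennreal_plus add_left_mono)
  qed
  have "(\<integral>\<^sup>+\<omega>. ?I \<omega> \<partial>M)
      = (\<integral>\<^sup>+z. (\<integral>\<^sup>+\<omega>. ennreal (s * exp (s * z)) * indicator {r..y} z * (if z < Z \<omega> then 1 else 0) \<partial>M) \<partial>lborel)"
  proof -
    \<comment> \<open>Tonelli: integrating over \<open>\<omega>\<close> first turns the indicator of
      \<open>z < Z \<omega>\<close> into the tail probability at \<open>z\<close>.\<close>
    interpret pair_sigma_finite lborel M ..
    show ?thesis by (rule Fubini') measurable
  qed
  also have "\<dots> \<le> (\<integral>\<^sup>+z. ennreal (s * C) * indicator {r..y} z \<partial>lborel)"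
  proof (rule nn_integral_mono)
    fix z :: real
    have "(\<integral>\<^sup>+\<omega>. ennreal (s * exp (s * z)) * indicator {r..y} z * (if z < Z \<omega> then 1 else 0) \<partial>M)
        = (\<integral>\<^sup>+\<omega>. (ennreal (s * exp (s * z)) * indicator {r..y} z) * indicator {\<omega> \<in> space M. z < Z \<omega>} \<omega> \<partial>M)"
      by (intro nn_integral_cong) (auto split: split_indicator)
    also have "\<dots> = ennreal (s * exp (s * z)) * indicator {r..y} z * \<P>(\<omega> in M. z < Z \<omega>)"
      by (subst nn_integral_cmult_indicator) (auto simp: emeasure_eq_measure)
    also have "\<dots> \<le> ennreal (s * C) * indicator {r..y} z"
    proof (cases "z \<in> {r..y}")
      case True
      then have "s * (exp (s * z) * \<P>(\<omega> in M. z < Z \<omega>)) \<le> s * C"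
        using s tail[of z] by (intro mult_left_mono) (auto simp: r_def)
      then show ?thesis using True s
        by (simp add: ennreal_leI mult.assoc flip: ennreal_mult)
    qed simp
    finally show "(\<integral>\<^sup>+\<omega>. ennreal (s * exp (s * z)) * indicator {r..y} z * (if z < Z \<omega> then 1 else 0) \<partial>M)
      \<le> ennreal (s * C) * indicator {r..y} z" .
  qed
  also have "\<dots> = ennreal (s * C * (y - r))"
    using r s C0 by (simp add: nn_integral_cmult_indicator ennreal_mult)
  finally have I: "(\<integral>\<^sup>+\<omega>. ?I \<omega> \<partial>M) \<le> ennreal (s * C * (y - r))" .
  have "(\<integral>\<^sup>+\<omega>. ennreal (exp (s * min (Z \<omega>) y)) \<partial>M) \<le> (\<integral>\<^sup>+\<omega>. ?Q \<omega> + ?I \<omega> \<partial>M)"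
    using pt by (rule nn_integral_mono)
  also have "\<dots> = (\<integral>\<^sup>+\<omega>. ?Q \<omega> \<partial>M) + (\<integral>\<^sup>+\<omega>. ?I \<omega> \<partial>M)"
    by (rule nn_integral_add) measurable
  also have "\<dots> \<le> ennreal (1 + s * expectation Z + s\<^sup>2 * expectation (\<lambda>\<omega>. (Z \<omega>)\<^sup>2) + C)
      + ennreal (s * C * (y - r))"
    by (intro add_mono Q I)
  also have "\<dots> = ennreal (1 + s * expectation Z + s\<^sup>2 * expectation (\<lambda>\<omega>. (Z \<omega>)\<^sup>2) + C + s * C * (y - r))"
    using nn r s C0 by (intro ennreal_plus[symmetric]) auto
  \<comment> \<open>As \<open>s * r = 1\<close>, the boundary term \<open>C\<close> cancels against
    \<open>- s * C * r\<close>.\<close>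
  also have "1 + s * expectation Z + s\<^sup>2 * expectation (\<lambda>\<omega>. (Z \<omega>)\<^sup>2) + C + s * C * (y - r)
      = 1 + s * expectation Z + s\<^sup>2 * expectation (\<lambda>\<omega>. (Z \<omega>)\<^sup>2) + s * y * C"
    using r by (simp add: algebra_simps)
  finally show ?thesis .
qed

section \<open>Positivity of the tail and maxima of convex functions\<close>

text \<open>If the tail vanished at \<open>z\<close>, then \<open>Z \<le> z\<close> almost surely
  and the exponential moment at 1 would be at most \<open>exp z\<close>. This positivity makes
  \<open>neg_log_tail\<close> a genuine logarithm of the tail.\<close>

lemma (in prob_space) tail_pos_if_mgf_infinite:
  fixes Z :: "'a \<Rightarrow> real"
  assumes Z [measurable]: "random_variable borel Z"
    and mgf: "\<And>s::real. s > 0 \<Longrightarrow> (\<integral>\<^sup>+\<omega>. ennreal (exp (s * Z \<omega>)) \<partial>M) = \<infinity>"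
  shows "0 < \<P>(\<omega> in M. z < Z \<omega>)"
proof (rule ccontr)
  assume "\<not> ?thesis"
  then have "prob {\<omega> \<in> space M. z < Z \<omega>} = 0"
    using measure_nonneg[of M] by (auto simp: not_less intro: antisym)
  then have "AE \<omega> in M. \<not> z < Z \<omega>"
    by (subst AE_iff_measurable[OF _ refl]) (auto simp: emeasure_eq_measure)
  then have "(\<integral>\<^sup>+\<omega>. ennreal (exp (1 * Z \<omega>)) \<partial>M) \<le> (\<integral>\<^sup>+\<omega>. ennreal (exp z) \<partial>M)"
    by (intro nn_integral_mono_AE) (auto elim!: eventually_mono)
  also have "\<dots> < \<infinity>" by (simp add: emeasure_space_1)
  finally show False using mgf[of 1] by simp
qed

text \<open>A convex function lies below its chord, hence below the larger of its endpoint values,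
  and \<open>exp\<close> is monotone. The weight \<open>t\<close> is set to 0 for a one-point
  interval.\<close>

lemma convex_exp_le_endpoint_bound:
  fixes h :: "real \<Rightarrow> real"
  assumes h: "convex_on {r..y} h" and z: "z \<in> {r..y}"
    and "exp (h r) \<le> C" "exp (h y) \<le> C"
  shows "exp (h z) \<le> C"
proof -
  define t where "t = (if r = y then 0 else (z - r) / (y - r))"
  have t: "0 \<le> t" "t \<le> 1" "z = (1 - t) * r + t * y"
    using z by (auto simp: t_def field_simps)
  have "h z \<le> (1 - t) * h r + t * h y"
    using convex_onD[OF h t(1,2), of r y] t z by simp
  also have "\<dots> \<le> max (h r) (h y)"
    using t by (intro convex_bound_le) auto
  finally show ?thesis
    using assms(3,4) by (auto simp: max_def intro: order_trans[rotated] split: if_splits)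
qed

section \<open>Choice of the threshold and of the exponent\<close>

theorem theorem1p2:
  fixes M :: "'a measure" and X :: "nat \<Rightarrow> 'a \<Rightarrow> real"
    and \<mu> \<kappa> y\<kappa> :: real and q :: "real \<Rightarrow> real"
  assumes "prob_space M"
    and "iid M X"
    and "integrable M (\<lambda>\<omega>. \<bar>X 1 \<omega>\<bar> ^ 2)"
    and "\<mu> = (\<integral>\<omega>. X 1 \<omega> \<partial>M)"
    and "\<mu> < 0"
    and "\<And>s::real. s > 0 \<Longrightarrow> (\<integral>\<^sup>+\<omega>. ennreal (exp (s * X 1 \<omega>)) \<partial>M) = \<infinity>"
    and "q = neg_log_tail M (X 1)"
    and "0 < \<kappa>" and "\<kappa> < 1" and "0 < y\<kappa>"
    and "\<And>y. y \<ge> y\<kappa> \<Longrightarrow> y \<ge> 1 \<Longrightarrow> (ln y) powr (1 + \<kappa>) \<le> q y"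
    and "\<And>y. y \<ge> y\<kappa> \<Longrightarrow> q y \<le> y powr (1 - \<kappa>)"
    and "concave_on {0<..} q"
  shows "\<forall>\<eta>. 0 < \<eta> \<and> \<eta> < 1 \<longrightarrow>
    (\<exists>ystar::real. \<forall>x y. x > 0 \<and> y > 0 \<and> y > ystar \<longrightarrow>
       \<P>(\<omega> in M. walk_sup X y \<omega> > ereal x)
         \<le> (y * \<P>(\<omega> in M. X 1 \<omega> > y) / (\<eta> * \<bar>\<mu>\<bar>)) powr (x / y))"
proof (intro allI impI, elim conjE)
  fix \<eta> :: real
  assume \<eta>: "0 < \<eta>" "\<eta> < 1"
  note iid = assms(2) and \<mu> = assms(4,5) and mgf_inf = assms(6) and q = assms(7) and \<kappa> = assms(8,9)
    and q_lower = assms(11) and q_upper = assms(12) and q_concave = assms(13)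
  interpret prob_space M by (fact assms(1))
  define p where "p z = \<P>(\<omega> in M. z < X 1 \<omega>)" for z
  define \<sigma> where "\<sigma> = expectation (\<lambda>\<omega>. (X 1 \<omega>)\<^sup>2)"
  define a where "a = \<eta> * \<bar>\<mu>\<bar>"
  have a: "0 < a" unfolding a_def using \<eta>(1) \<mu>(2) by (intro mult_pos_pos) auto
  have indep: "indep_vars (\<lambda>_. borel) X {1..}"
    and distr: "\<And>i. 1 \<le> i \<Longrightarrow> distr M borel (X i) = distr M borel (X 1)"
    using iid unfolding iid_def by blast+
  have rv: "X i \<in> borel_measurable M" if "1 \<le> i" for i
    using indep that by (auto simp: indep_vars_def)
  have p_eq: "p z = exp (- q z)" for z
    using tail_pos_if_mgf_infinite[OF rv[OF order_refl] mgf_inf, of z] by (simp add: p_def q neg_log_tail_def)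
  have p_mono: "p z \<le> p w" if "w \<le> z" for w z
    unfolding p_def using rv[of 1] that by (intro finite_measure_mono) auto
  have int2: "integrable M (\<lambda>\<omega>. (X 1 \<omega>)\<^sup>2)" using assms(3) by simp

  \<comment> \<open>These conditions serve, in order, to give \<open>s * y \<ge> 1\<close>, to
    absorb the second-moment term, to bound the left endpoint \<open>1 / s\<close>
    (\<open>(\<kappa> * ln y) powr (1 + \<kappa>)\<close> outgrows \<open>ln y\<close>), and to make
    the lower bound on \<open>q\<close> applicable at \<open>y powr \<kappa>\<close>. The condition
    \<open>y \<ge> a\<close> added below gives \<open>L \<le> q y\<close>.\<close>
  have "\<forall>\<^sub>F y in at_top. (ln y) powr (1 + \<kappa>) - ln y + ln a \<ge> 1"
    using \<kappa> by real_asymp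
  moreover have "\<forall>\<^sub>F y in at_top. y powr (- \<kappa>) * \<sigma> < (1 - \<eta>) * \<bar>\<mu>\<bar>"
  proof -
    have "((\<lambda>y. y powr (- \<kappa>) * \<sigma>) \<longlongrightarrow> 0 * \<sigma>) at_top"
      using \<kappa> by (intro tendsto_mult_right) real_asymp
    then show ?thesis using \<eta> \<mu>(2) by (intro order_tendstoD(2)) (auto simp: mult_less_0_iff)
  qed
  moreover have "\<forall>\<^sub>F y in at_top. y * exp (- (ln (y powr \<kappa>) powr (1 + \<kappa>))) < a / exp 1"
  proof -
    have "((\<lambda>y. y * exp (- (ln (y powr \<kappa>) powr (1 + \<kappa>)))) \<longlongrightarrow> 0) at_top"
      using \<kappa> by real_asymp
    then show ?thesis using a by (intro order_tendstoD(2)) auto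
  qed
  moreover have "\<forall>\<^sub>F y in at_top. y powr \<kappa> \<ge> max y\<kappa> 1"
    using \<kappa> by real_asymp
  ultimately have "\<forall>\<^sub>F y in at_top.
      (ln y) powr (1 + \<kappa>) - ln y + ln a \<ge> 1 \<and> y powr (- \<kappa>) * \<sigma> < (1 - \<eta>) * \<bar>\<mu>\<bar> \<and>
      y * exp (- (ln (y powr \<kappa>) powr (1 + \<kappa>))) < a / exp 1 \<and> y powr \<kappa> \<ge> max y\<kappa> 1 \<and>
      y \<ge> y\<kappa> \<and> y \<ge> 1 \<and> y \<ge> a"
    by (intro eventually_conj eventually_ge_at_top)
  then obtain ystar where ystar: "\<And>y. y \<ge> ystar \<Longrightarrow>
      (ln y) powr (1 + \<kappa>) - ln y + ln a \<ge> 1 \<and> y powr (- \<kappa>) * \<sigma> < (1 - \<eta>) * \<bar>\<mu>\<bar> \<and>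
      y * exp (- (ln (y powr \<kappa>) powr (1 + \<kappa>))) < a / exp 1 \<and> y powr \<kappa> \<ge> max y\<kappa> 1 \<and>
      y \<ge> y\<kappa> \<and> y \<ge> 1 \<and> y \<ge> a"
    unfolding eventually_at_top_linorder by blast
  show "\<exists>ystar::real. \<forall>x y. x > 0 \<and> y > 0 \<and> y > ystar \<longrightarrow>
       \<P>(\<omega> in M. walk_sup X y \<omega> > ereal x)
         \<le> (y * \<P>(\<omega> in M. X 1 \<omega> > y) / (\<eta> * \<bar>\<mu>\<bar>)) powr (x / y)"
  proof (intro exI[of _ ystar] allI impI, elim conjE)
    fix x y :: real
    assume "x > 0" and y: "y > 0" and "y > ystar"
    then have large: "(ln y) powr (1 + \<kappa>) - ln y + ln a \<ge> 1"
        "y powr (- \<kappa>) * \<sigma> < (1 - \<eta>) * \<bar>\<mu>\<bar>"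
        "y * exp (- (ln (y powr \<kappa>) powr (1 + \<kappa>))) < a / exp 1"
        "y powr \<kappa> \<ge> y\<kappa>" "y powr \<kappa> \<ge> 1" "y \<ge> y\<kappa>" "y \<ge> 1" "y \<ge> a"
      using ystar[of y] by auto
    \<comment> \<open>Chosen so that \<open>exp (- L) = y * p y / a\<close>; thus
      \<open>exp (- (s * x))\<close> is the claimed bound, and \<open>exp (s * y - q y)\<close> is
      exactly \<open>a / y\<close>.\<close>
    define L where "L = q y - ln y + ln a"
    define s where "s = L / y"
    have sy: "s * y = L" using y by (simp add: s_def)
    have L1: "1 \<le> L" using large(1) q_lower[of y] large(6,7) by (simp add: L_def)
    then have s: "0 < s" using y by (simp add: s_def)
    have "ln a \<le> ln y" using large(8) a y by simp
    then have "L \<le> y powr (1 - \<kappa>)"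
      using q_upper[of y] large(6) by (simp add: L_def)
    then have "s \<le> y powr (1 - \<kappa>) / y"
      using y by (simp add: s_def divide_right_mono)
    also have "\<dots> = y powr (- \<kappa>)"
      using y by (simp add: powr_diff powr_minus field_simps)
    finally have s_le: "s \<le> y powr (- \<kappa>)" .
    have "y powr \<kappa> \<le> 1 / s"
      using s_le s y by (simp add: powr_minus field_simps)
    then have "p (1 / s) \<le> p (y powr \<kappa>)" by (rule p_mono)
    also have "\<dots> \<le> exp (- (ln (y powr \<kappa>) powr (1 + \<kappa>)))"
      using q_lower[of "y powr \<kappa>"] large(4,5) by (simp add: p_eq)
    finally have "y * p (1 / s) \<le> y * exp (- (ln (y powr \<kappa>) powr (1 + \<kappa>)))"
      using y by simp
    also have "\<dots> \<le> a / exp 1" using large(3) by simp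
    finally have left: "exp 1 * p (1 / s) \<le> a / y" using y by (simp add: field_simps)

    have tail: "exp (s * z) * p z \<le> a / y" if z: "1 / s \<le> z" "z \<le> y" for z
    proof -
      have "0 < 1 / s" using s by simp
      then have "{1 / s..y} \<subseteq> {0<..}" by (meson atLeastAtMost_iff greaterThan_iff less_le_trans subsetI)
      \<comment> \<open>Concavity of \<open>q\<close> enters here: the exponent
        \<open>s * z - q z\<close> is linear plus convex, so its endpoints decide.\<close>
      then have "convex_on {1 / s..y} (\<lambda>z. - q z)"
        using q_concave convex_on_subset[of "{0<..}" "\<lambda>z. - q z" "{1 / s..y}"]
        unfolding concave_on_def by simp
      moreover have "convex_on {1 / s..y} (\<lambda>z. s * z)"
        using s by (intro convex_on_cmul) (simp_all add: convex_on_ident)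
      ultimately have "convex_on {1 / s..y} (\<lambda>z. s * z + - q z)"
        using convex_on_add[of "{1 / s..y}" "\<lambda>z. s * z" "\<lambda>z. - q z"] by simp
      moreover have "exp (s * (1 / s) + - q (1 / s)) \<le> a / y"
        using left s by (simp add: p_eq exp_diff exp_minus field_simps)
      moreover have "exp (s * y + - q y) \<le> a / y"
        using a y by (simp add: sy L_def exp_add exp_diff)
      ultimately have "exp (s * z + - q z) \<le> a / y"
        using z
        by (intro convex_exp_le_endpoint_bound[of "1 / s" y "\<lambda>z. s * z + - q z" z])
          (simp_all only: atLeastAtMost_iff)
      then show ?thesis by (simp only: p_eq exp_add)
    qed

    have "(\<integral>\<^sup>+\<omega>. ennreal (exp (s * min (X 1 \<omega>) y)) \<partial>M)
        \<le> ennreal (1 + s * expectation (X 1) + s\<^sup>2 * \<sigma> + s * y * (a / y))"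
      unfolding \<sigma>_def using s tail L1 sy rv[of 1] int2
      by (intro truncated_mgf_le) (auto simp: p_def)
    also have "1 + s * expectation (X 1) + s\<^sup>2 * \<sigma> + s * y * (a / y) = 1 + s * (\<mu> + s * \<sigma> + a)"
      using y by (simp add: \<mu>(1) algebra_simps power2_eq_square)
    also have "\<dots> \<le> 1"
    proof -
      \<comment> \<open>The tail integral costs \<open>a = \<eta> * \<bar>\<mu>\<bar>\<close> of the
        negative drift. The remaining \<open>(1 - \<eta>) * \<bar>\<mu>\<bar> = - \<mu> - a\<close>
        dominates \<open>s * \<sigma>\<close>.\<close>
      have "s * \<sigma> \<le> y powr (- \<kappa>) * \<sigma>"
        using s_le by (intro mult_right_mono) (auto simp: \<sigma>_def)
      also have "\<dots> \<le> - \<mu> - a"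
        using large(2) \<mu>(2) by (simp add: a_def algebra_simps)
      finally show ?thesis using s by (simp add: mult_nonneg_nonpos)
    qed
    finally have mgf1: "(\<integral>\<^sup>+\<omega>. ennreal (exp (s * min (X 1 \<omega>) y)) \<partial>M) \<le> 1"
      by (simp add: ennreal_leI)
    have mgf: "(\<integral>\<^sup>+\<omega>. ennreal (exp (s * min (X i \<omega>) y)) \<partial>M) \<le> 1" if i: "1 \<le> i" for i
    proof -
      have "(\<integral>\<^sup>+\<omega>. ennreal (exp (s * min (X i \<omega>) y)) \<partial>M)
          = (\<integral>\<^sup>+z. ennreal (exp (s * min z y)) \<partial>distr M borel (X i))"
        using rv[OF i] by (intro nn_integral_distr[symmetric]) auto
      also have "\<dots> = (\<integral>\<^sup>+z. ennreal (exp (s * min z y)) \<partial>distr M borel (X 1))"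
        by (simp only: distr[OF i])
      also have "\<dots> = (\<integral>\<^sup>+\<omega>. ennreal (exp (s * min (X 1 \<omega>) y)) \<partial>M)"
        using rv[of 1] by (intro nn_integral_distr) auto
      finally show ?thesis using mgf1 by simp
    qed
    have "indep_vars (\<lambda>_. borel) (\<lambda>i \<omega>. min (X i \<omega>) y) {1..}"
      by (rule indep_vars_compose2[OF indep]) auto
    then have "prob {\<omega> \<in> space M. \<exists>n. x < (\<Sum>i=1..n. min (X i \<omega>) y)} \<le> exp (- (s * x))"
      using s mgf by (intro Lundberg_inequality) auto
    \<comment> \<open>A supremum strictly exceeds a level exactly when some member does, so neither
      attainment nor finiteness matters.\<close>
    also have "{\<omega> \<in> space M. \<exists>n. x < (\<Sum>i=1..n. min (X i \<omega>) y)}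
        = {\<omega> \<in> space M. walk_sup X y \<omega> > ereal x}"
      by (simp add: walk_sup_def truncated_walk_def less_SUP_iff)
    also have "exp (- (s * x)) = (y * p y / a) powr (x / y)"
    proof -
      have "y * p y / a = exp (- L)"
        using y a by (simp add: L_def p_eq exp_diff exp_add exp_minus field_simps)
      then show ?thesis by (simp add: powr_def s_def)
    qed
    finally show "\<P>(\<omega> in M. walk_sup X y \<omega> > ereal x)
         \<le> (y * \<P>(\<omega> in M. X 1 \<omega> > y) / (\<eta> * \<bar>\<mu>\<bar>)) powr (x / y)"
      by (simp add: p_def a_def)
  qed
qed

end
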